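(* Let $G$ be an infinite ordered group and $T = \mathrm{Th}(G; +, <)$. Then $T$ is dp-small if and only if $G$ is abelian and divisible.
   Context: For a complete theory $T$ in language $L$ with monster model $\mathcal{U}$ ($\mathcal{U}_y$ the $|y|$-tuples from $\mathcal{U}$): a partial type $\pi(x)$ is dp-small if there do not exist $L(\mathcal{U})$-formulas $\varphi_i(x)$ ($i<\omega$), an $L$-formula $\psi(x;y)$ and $b_j\in\mathcal{U}_y$ ($j<\omega$) such that for all $i_0,j_0<\omega$ the type $\pi(x)\cup\{\varphi_{i_0}(x),\psi(x;b_{j_0})\}\cup\{\neg\varphi_i(x): i\ne i_0\}\cup\{\neg\psi(x;b_j): j\neq j_0\}$ is consistent. $T$ is dp-small if $x=x$ is dp-small for $x$ a single variable. *)

theory Defs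
  imports Main "HOL-Library.Countable_Set"
begin

datatype tm = V nat | Pl tm tm

datatype fm = Eq tm tm | Lt tm tm | Neg fm | Conj fm fm | Ex nat fm

fun evalt :: "('m \<Rightarrow> 'm \<Rightarrow> 'm) \<Rightarrow> tm \<Rightarrow> (nat \<Rightarrow> 'm) \<Rightarrow> 'm" where
  "evalt pl (V n) e = e n"
| "evalt pl (Pl s t) e = pl (evalt pl s e) (evalt pl t e)"

fun sat :: "('m \<Rightarrow> 'm \<Rightarrow> 'm) \<Rightarrow> ('m \<Rightarrow> 'm \<Rightarrow> bool) \<Rightarrow> fm \<Rightarrow> (nat \<Rightarrow> 'm) \<Rightarrow> bool" where
  "sat pl ls (Eq s t) e = (evalt pl s e = evalt pl t e)"
| "sat pl ls (Lt s t) e = ls (evalt pl s e) (evalt pl t e)"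
| "sat pl ls (Neg \<phi>) e = (\<not> sat pl ls \<phi> e)"
| "sat pl ls (Conj \<phi> \<chi>) e = (sat pl ls \<phi> e \<and> sat pl ls \<chi> e)"
| "sat pl ls (Ex n \<phi>) e = (\<exists>a. sat pl ls \<phi> (e(n := a)))"

fun fvt :: "tm \<Rightarrow> nat set" where
  "fvt (V n) = {n}"
| "fvt (Pl s t) = fvt s \<union> fvt t"

fun fv :: "fm \<Rightarrow> nat set" where
  "fv (Eq s t) = fvt s \<union> fvt t"
| "fv (Lt s t) = fvt s \<union> fvt t"
| "fv (Neg \<phi>) = fv \<phi>"
| "fv (Conj \<phi> \<chi>) = fv \<phi> \<union> fv \<chi>"
| "fv (Ex n \<phi>) = fv \<phi> - {n}"

text \<open>U = (UNIV::'m set; pl, ls) is a model of T = Th(G; +, <), where G is the type 'g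
  with its own + and <.  Since T is complete, this is elementary equivalence.\<close>
definition models_Th :: "'g::{plus,ord} itself \<Rightarrow> ('m \<Rightarrow> 'm \<Rightarrow> 'm) \<Rightarrow> ('m \<Rightarrow> 'm \<Rightarrow> bool) \<Rightarrow> bool" where
  "models_Th _ pl ls \<longleftrightarrow>
     (\<forall>\<phi>. fv \<phi> = {} \<longrightarrow> (\<forall>e::nat \<Rightarrow> 'g. sat (+) (<) \<phi> e) \<longrightarrow> (\<forall>e. sat pl ls \<phi> e))"

text \<open>An L(U)-formula in the single variable x is a pair (\<phi>, e): an L-formula \<phi> whose
  variable 0 is x, all other variables being interpreted by the parameters e.
  A set of such formulas (a partial 1-type) is realized by a if all hold with x := a.\<close>
definition realizes :: "('m \<Rightarrow> 'm \<Rightarrow> 'm) \<Rightarrow> ('m \<Rightarrow> 'm \<Rightarrow> bool) \<Rightarrow> 'm \<Rightarrow> (fm \<times> (nat \<Rightarrow> 'm)) set \<Rightarrow> bool" where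
  "realizes pl ls a P \<longleftrightarrow> (\<forall>(\<phi>, e) \<in> P. sat pl ls \<phi> (e(0 := a)))"

text \<open>Consistency of a partial type over U (with T(U)) = finite satisfiability in U.\<close>
definition consistent :: "('m \<Rightarrow> 'm \<Rightarrow> 'm) \<Rightarrow> ('m \<Rightarrow> 'm \<Rightarrow> bool) \<Rightarrow> (fm \<times> (nat \<Rightarrow> 'm)) set \<Rightarrow> bool" where
  "consistent pl ls P \<longleftrightarrow> (\<forall>F. finite F \<and> F \<subseteq> P \<longrightarrow> (\<exists>a. realizes pl ls a F))"

definition monster :: "'g::{plus,ord} itself \<Rightarrow> ('m \<Rightarrow> 'm \<Rightarrow> 'm) \<Rightarrow> ('m \<Rightarrow> 'm \<Rightarrow> bool) \<Rightarrow> bool" where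
  "monster G pl ls \<longleftrightarrow> models_Th G pl ls \<and>
     (\<forall>P. countable P \<and> consistent pl ls P \<longrightarrow> (\<exists>a. realizes pl ls a P))"

text \<open>dp-smallness of T, computed in the monster model U: there are no L(U)-formulas
  \<phi>_i(x) (pairs (\<phi> i, c i)), L-formula \<psi>(x;y) (x = variable 0, y = the others) and
  parameters b_j such that all the types below are consistent.\<close>
definition dp_small :: "('m \<Rightarrow> 'm \<Rightarrow> 'm) \<Rightarrow> ('m \<Rightarrow> 'm \<Rightarrow> bool) \<Rightarrow> bool" where
  "dp_small pl ls \<longleftrightarrow> \<not> (\<exists>(\<phi>::nat \<Rightarrow> fm) (c::nat \<Rightarrow> nat \<Rightarrow> 'm) (\<psi>::fm) (b::nat \<Rightarrow> nat \<Rightarrow> 'm).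
     \<forall>i0 j0. consistent pl ls
       ({(\<phi> i0, c i0), (\<psi>, b j0)}
        \<union> {(Neg (\<phi> i), c i) | i. i \<noteq> i0}
        \<union> {(Neg \<psi>, b j) | j. j \<noteq> j0}))"

definition nmul :: "nat \<Rightarrow> 'g::group_add \<Rightarrow> 'g" where
  "nmul n g = ((\<lambda>x. x + g) ^^ n) 0"

definition divisible_grp :: "'g::group_add itself \<Rightarrow> bool" where
  "divisible_grp _ \<longleftrightarrow> (\<forall>(a::'g) (n::nat). n \<ge> 1 \<longrightarrow> (\<exists>g. nmul n g = a))"

definition abelian_grp :: "'g::group_add itself \<Rightarrow> bool" where
  "abelian_grp _ \<longleftrightarrow> (\<forall>a b::'g. a + b = b + a)"

definition ordered_grp :: "'g::{group_add,linorder} itself \<Rightarrow> bool" where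
  "ordered_grp _ \<longleftrightarrow> (\<forall>a b c::'g. a < b \<longrightarrow> c + a < c + b \<and> a + c < b + c)"

end

theory Submission
  imports Defs "HOL-Algebra.Group"
begin

text \<open>By saturation, dp-smallness fails iff there is an array of points \<open>x i j\<close> such that \<open>x i j\<close>
  satisfies exactly the \<open>i\<close>-th \<open>\<phi>\<close> and the \<open>j\<close>-th instance of \<open>\<psi>\<close>.

  If \<open>a\<close> and \<open>b\<close> do not commute, then neither do their positive powers, because the order is
  bi-invariant. So by saturation \<open>b > 1\<close> and \<open>a\<close> can be chosen with \<open>a\<close> above all powers of \<open>b\<close>;
  the cosets \<open>b^i C(a)\<close> are pairwise distinct and each meets every interval \<open>[a^j, a^(j+1))\<close>,
  in \<open>b^i a^j\<close>. If \<open>G\<close> is abelian and \<open>g > 1\<close> has no \<open>n\<close>-th root, choose \<open>h\<close> above all \<open>g^(n^i)\<close>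
  with an \<open>n^i\<close>-th root for all \<open>i\<close>; the points \<open>g^(n^i) h^j\<close> in the intervals \<open>[h^j, h^(j+1))\<close> have an
  \<open>n^i\<close>-th but no \<open>n^(i+1)\<close>-th root.

  If \<open>G\<close> is abelian and divisible, quantifier elimination makes every definable set a finite union
  of convex sets, with a uniform bound for the instances of \<open>\<psi>\<close>. Given more rows than this
  bound, in each column \<open>j\<close> two points of different rows lie in one convex component of
  the \<open>j\<close>-th instance of \<open>\<psi>\<close>. For some \<open>j \<noteq> j'\<close> the two rows and the convex pieces (with respect to the
  \<open>\<phi>\<close>s) containing the points agree, so one of the two components contains a point of
  the other column.\<close>

section \<open>Arrays\<close>

text \<open>The types in the definition are countable, so saturation turns their consistency into
  realization; choice collects the realizations in \<open>x\<close>.\<close>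

lemma monster_dp_small_iff:
  fixes pl :: "'m \<Rightarrow> 'm \<Rightarrow> 'm"
  assumes sat: "\<forall>P. countable P \<and> consistent pl ls P \<longrightarrow> (\<exists>a. realizes pl ls a P)"
  shows "dp_small pl ls \<longleftrightarrow> \<not> (\<exists>\<phi> c \<psi> b x. \<forall>i j :: nat.
     (\<forall>i' :: nat. sat pl ls (\<phi> i') ((c i')(0 := x i j)) \<longleftrightarrow> i' = i) \<and>
     (\<forall>j' :: nat. sat pl ls \<psi> ((b j')(0 := x i j)) \<longleftrightarrow> j' = j))"
proof -
  have *: "consistent pl ls
       ({(\<phi> i, c i), (\<psi>, b j)} \<union> {(Neg (\<phi> i'), c i') | i'. i' \<noteq> i} \<union> {(Neg \<psi>, b j') | j'. j' \<noteq> j})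
     \<longleftrightarrow> (\<exists>x. (\<forall>i'. sat pl ls (\<phi> i') ((c i')(0 := x)) \<longleftrightarrow> i' = i) \<and>
             (\<forall>j'. sat pl ls \<psi> ((b j')(0 := x)) \<longleftrightarrow> j' = j))" (is "consistent _ _ ?P \<longleftrightarrow> ?R")
    for \<phi> :: "nat \<Rightarrow> fm" and c \<psi> and b :: "nat \<Rightarrow> nat \<Rightarrow> 'm" and i j
  proof -
    have real: "(\<exists>a. realizes pl ls a ?P) \<longleftrightarrow> ?R"
      unfolding realizes_def setcompr_eq_image by (rule ex_cong1) (auto simp: ball_Un)
    have "countable {(Neg (\<phi> i'), c i') | i'. i' \<noteq> i}" "countable {(Neg \<psi>, b j') | j'. j' \<noteq> j}"
      unfolding setcompr_eq_image by simp_all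
    then have "countable ?P" by simp
    then have "consistent pl ls ?P \<longleftrightarrow> (\<exists>a. realizes pl ls a ?P)"
      using sat unfolding consistent_def realizes_def by (meson subsetD)
    then show ?thesis using real by simp
  qed
  show ?thesis unfolding dp_small_def * choice_iff by (rule refl)
qed

section \<open>Bi-invariantly ordered groups\<close>

locale ord_group = group G for G :: "'m monoid" (structure) +
  fixes ls :: "'m \<Rightarrow> 'm \<Rightarrow> bool" (infix "\<prec>" 50)
  assumes carrier_UNIV [simp]: "carrier G = UNIV"
    and irrefl [simp]: "\<not> x \<prec> x"
    and trans: "x \<prec> y \<Longrightarrow> y \<prec> z \<Longrightarrow> x \<prec> z"
    and total: "x \<prec> y \<or> x = y \<or> y \<prec> x"
    and mult_less_left: "x \<prec> y \<Longrightarrow> z \<otimes> x \<prec> z \<otimes> y"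
    and mult_less_right: "x \<prec> y \<Longrightarrow> x \<otimes> z \<prec> y \<otimes> z"
begin

lemma asym: "x \<prec> y \<Longrightarrow> \<not> y \<prec> x"
  using trans irrefl by blast

lemma not_less_trans: "\<not> y \<prec> x \<Longrightarrow> y \<prec> z \<Longrightarrow> x \<prec> z"
  using trans total by blast

lemma less_not_trans: "x \<prec> y \<Longrightarrow> \<not> z \<prec> y \<Longrightarrow> x \<prec> z"
  using trans total by blast

lemma mult_less_left_iff [simp]: "z \<otimes> x \<prec> z \<otimes> y \<longleftrightarrow> x \<prec> y"
  by (metis mult_less_left total irrefl trans)

lemma mult_less_right_iff [simp]: "x \<otimes> z \<prec> y \<otimes> z \<longleftrightarrow> x \<prec> y"
  by (metis mult_less_right total irrefl trans)

lemma mult_strict_mono: "x \<prec> y \<Longrightarrow> u \<prec> v \<Longrightarrow> x \<otimes> u \<prec> y \<otimes> v"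
  using trans mult_less_left mult_less_right by blast

lemma pow_strict_mono: "x \<prec> y \<Longrightarrow> x [^] Suc n \<prec> y [^] Suc n"
  by (induction n) (use mult_strict_mono in auto)

lemma pow_less_iff: "n > 0 \<Longrightarrow> x [^] (n::nat) \<prec> y [^] n \<longleftrightarrow> x \<prec> y"
  by (cases n) (simp, use pow_strict_mono total irrefl trans in blast)

lemma pow_inj: "n > 0 \<Longrightarrow> x [^] (n::nat) = y [^] n \<longleftrightarrow> x = y"
  by (metis pow_less_iff total irrefl)

lemma one_less_pow: "\<one> \<prec> x \<Longrightarrow> n > 0 \<Longrightarrow> \<one> \<prec> x [^] (n::nat)"
  using pow_less_iff[of n \<one> x] by simp

lemma pow_less_pow: "\<one> \<prec> x \<Longrightarrow> m < n \<Longrightarrow> x [^] (m::nat) \<prec> x [^] (n::nat)"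
  using mult_less_left[OF one_less_pow[of x "n - m"], of "x [^] m"]
    nat_pow_mult[of x m "n - m"] by simp

lemma pow_le_pow: "\<one> \<prec> x \<Longrightarrow> m \<le> n \<Longrightarrow> \<not> x [^] (n::nat) \<prec> x [^] (m::nat)"
  using pow_less_pow[of x m n] trans[of "x [^] n" "x [^] m" "x [^] n"] by (cases "m = n") auto

lemma one_less_inv_iff: "\<one> \<prec> inv x \<longleftrightarrow> x \<prec> \<one>"
  using mult_less_left_iff[of x \<one> "inv x"] by simp

lemma conj_pow: "(inv b \<otimes> a \<otimes> b) [^] (n::nat) = inv b \<otimes> a [^] n \<otimes> b"
proof (induction n)
  case (Suc n)
  have "inv b \<otimes> a [^] n \<otimes> b \<otimes> (inv b \<otimes> a \<otimes> b) = inv b \<otimes> a [^] n \<otimes> (b \<otimes> inv b) \<otimes> a \<otimes> b"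
    by (simp only: m_assoc carrier_UNIV UNIV_I)
  then show ?case using Suc by (simp add: m_assoc)
qed simp

text \<open>The element \<open>a\<close> and its conjugate by \<open>b\<close> have the same
  \<open>n\<close>-th power, so they are equal by injectivity of powers.\<close>

lemma commute_pow:
  assumes "n > 0" "a [^] (n::nat) \<otimes> b = b \<otimes> a [^] n"
  shows "a \<otimes> b = b \<otimes> a"
proof -
  have "(inv b \<otimes> a \<otimes> b) [^] n = a [^] n"
    unfolding conj_pow using assms(2) by (simp add: m_assoc flip: m_assoc[of "inv b" b])
  then have "inv b \<otimes> a \<otimes> b = a" using assms(1) pow_inj by blast
  then show ?thesis by (metis UNIV_I carrier_UNIV inv_solve_left m_assoc inv_closed)
qed

text \<open>Right multiplication by \<open>a [^] j\<close> carries [1, a) to the \<open>j\<close>-th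
  of the disjoint intervals between consecutive powers of \<open>a\<close>.\<close>

lemma interval_pow_iff:
  assumes "\<not> y \<prec> \<one>" "y \<prec> a"
  shows "\<not> y \<otimes> a [^] j \<prec> a [^] j' \<and> y \<otimes> a [^] j \<prec> a [^] Suc j' \<longleftrightarrow> j' = (j::nat)"
proof -
  have a: "\<one> \<prec> a" using assms by (metis total trans)
  have 1: "\<not> y \<otimes> a [^] j \<prec> a [^] j"
    using mult_less_right_iff[of y "a [^] j" \<one>] assms(1) by simp
  have 2: "y \<otimes> a [^] j \<prec> a [^] Suc j"
    using mult_less_right[OF assms(2), of "a [^] j"] nat_pow_Suc2[of a j] by simp
  show ?thesis
  proof (cases j' j rule: linorder_cases)
    case less
    then have "\<not> a [^] j \<prec> a [^] Suc j'" using pow_le_pow[OF a, of "Suc j'" j] by simp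
    then show ?thesis using 1 less less_not_trans by blast
  next
    case greater
    then have "\<not> a [^] j' \<prec> a [^] Suc j" using pow_le_pow[OF a, of "Suc j" j'] by simp
    then show ?thesis using 2 greater less_not_trans by blast
  qed (use 1 2 in simp)
qed

end

section \<open>Non-abelian groups\<close>

locale saturated_ord_group = ord_group +
  assumes saturated: "\<forall>P. countable P \<and> consistent (\<otimes>) (\<prec>) P \<longrightarrow> (\<exists>a. realizes (\<otimes>) (\<prec>) a P)"
begin

lemmas dp_small_iff = monster_dp_small_iff[OF saturated]

text \<open>Every finite part of the type lies in an initial segment, so saturation applies.\<close>

lemma realize_sequence:
  assumes "\<And>m::nat. \<exists>x. \<forall>i\<le>m. sat (\<otimes>) (\<prec>) (p i) ((e i)(0 := x))"
  shows "\<exists>x. \<forall>i. sat (\<otimes>) (\<prec>) (p i) ((e i)(0 := x))"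
proof -
  let ?p = "\<lambda>i. (p i, e i)"
  have "consistent (\<otimes>) (\<prec>) (range ?p)"
    unfolding consistent_def
  proof (intro allI impI, elim conjE)
    fix F assume F: "finite F" "F \<subseteq> range ?p"
    then obtain I where I: "finite I" "F = ?p ` I"
      using finite_subset_image[of F ?p UNIV] by blast
    obtain m where "\<forall>i\<in>I. i \<le> m" using Max_ge[OF I(1)] by blast
    then show "\<exists>x. realizes (\<otimes>) (\<prec>) x F"
      using assms[of m] unfolding realizes_def I(2) by fastforce
  qed
  then have "\<exists>a. realizes (\<otimes>) (\<prec>) a (range ?p)"
    using saturated by simp
  then show ?thesis unfolding realizes_def by auto
qed

text \<open>The columns are the intervals between consecutive powers of \<open>a\<close>; only the
  rows remain to be supplied.\<close>

lemma not_dp_smallI: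
  fixes y :: "nat \<Rightarrow> 'a"
  assumes "\<And>i i' j. sat (\<otimes>) (\<prec>) (\<phi> i') ((c i')(0 := y i \<otimes> a [^] (j::nat))) \<longleftrightarrow> i' = i"
    and "\<And>i. \<not> y i \<prec> \<one>" "\<And>i. y i \<prec> a"
  shows "\<not> dp_small (\<otimes>) (\<prec>)"
proof -
  let ?\<psi> = "Conj (Neg (Lt (V 0) (V 1))) (Lt (V 0) (V 2))"
  let ?b = "\<lambda>j n. if n = 1 then a [^] j else a [^] Suc j"
  have "sat (\<otimes>) (\<prec>) ?\<psi> ((?b j')(0 := y i \<otimes> a [^] j)) \<longleftrightarrow> j' = j" for i j j' :: nat
    using interval_pow_iff[OF assms(2,3), of i j j'] by simp
  with assms(1) show ?thesis unfolding dp_small_iff not_not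
    by (intro exI[of _ \<phi>] exI[of _ c] exI[of _ ?\<psi>] exI[of _ ?b] exI[of _ "\<lambda>i j. y i \<otimes> a [^] j"]) simp
qed

lemma dominated_pair_not_dp_small:
  assumes "\<one> \<prec> b" "\<And>i::nat. b [^] i \<prec> a" "a \<otimes> b \<noteq> b \<otimes> a"
  shows "\<not> dp_small (\<otimes>) (\<prec>)"
proof (rule not_dp_smallI)
  \<comment> \<open>With parameters \<open>?c i\<close> this defines the coset of the centralizer of
    \<open>a\<close> by \<open>b [^] i\<close>; variable 3 ranges over the centralizer.\<close>
  let ?\<phi> = "Ex 3 (Conj (Eq (V 0) (Pl (V 1) (V 3))) (Eq (Pl (V 3) (V 2)) (Pl (V 2) (V 3))))"
  let ?c = "\<lambda>i n. if n = 1 then b [^] i else a"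
  fix i i' j :: nat
  \<comment> \<open>If two of the cosets met, a positive power of \<open>b\<close>, hence
    \<open>b\<close> itself, would commute with \<open>a\<close>.\<close>
  have aux: False if "i < i'" "b [^] i \<otimes> y = b [^] i' \<otimes> y'"
     "y \<otimes> a = a \<otimes> y" "y' \<otimes> a = a \<otimes> y'" for i i' :: nat and y y'
  proof -
    let ?d = "b [^] (i' - i)"
    have "b [^] i' = b [^] i \<otimes> ?d" using that(1) using nat_pow_mult[of b i "i' - i"] by simp
    then have y: "y = ?d \<otimes> y'" using that(2) by (simp add: m_assoc)
    have "?d \<otimes> a \<otimes> y' = ?d \<otimes> y' \<otimes> a" using that(4) by (simp add: m_assoc)
    also have "\<dots> = a \<otimes> ?d \<otimes> y'" using that(3) y by (simp add: m_assoc)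
    finally have "?d \<otimes> a = a \<otimes> ?d" by simp
    then show False using commute_pow[of "i' - i" b a] that(1) assms(3) by simp
  qed
  have comm: "a [^] j \<otimes> a = a \<otimes> a [^] j" by (metis nat_pow_Suc nat_pow_Suc2 UNIV_I carrier_UNIV)
  show "sat (\<otimes>) (\<prec>) ?\<phi> ((?c i')(0 := b [^] i \<otimes> a [^] j)) \<longleftrightarrow> i' = i"
  proof
    assume "sat (\<otimes>) (\<prec>) ?\<phi> ((?c i')(0 := b [^] i \<otimes> a [^] j))"
    then obtain y where "b [^] i \<otimes> a [^] j = b [^] i' \<otimes> y" "y \<otimes> a = a \<otimes> y" by auto
    then show "i' = i" using aux[of i i' "a [^] j" y] aux[of i' i y "a [^] j"] comm
      by (metis linorder_neqE_nat)
  qed (use comm in auto)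
  show "\<not> b [^] i \<prec> \<one>" using pow_le_pow[OF assms(1), of 0 i] by simp
  show "b [^] i \<prec> a" by fact
qed

text \<open>Either powers of \<open>a\<close> exceed every power of \<open>b\<close>, and saturation
  yields a replacement for \<open>a\<close> above all of these, or some power of \<open>b\<close>
  bounds all powers of \<open>a\<close> and the roles are exchanged.\<close>

lemma not_dp_small_if_noncommuting_pos:
  assumes "\<one> \<prec> a" "\<one> \<prec> b" "a \<otimes> b \<noteq> b \<otimes> a"
  shows "\<not> dp_small (\<otimes>) (\<prec>)"
proof (cases "\<forall>n::nat. \<exists>N::nat. b [^] n \<prec> a [^] N")
  case True
  let ?p = "Conj (Lt (V 1) (V 0)) (Neg (Eq (Pl (V 0) (V 2)) (Pl (V 2) (V 0))))"
  let ?e = "\<lambda>i k. if k = 1 then b [^] (i::nat) else b"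
  have "\<exists>x. \<forall>i\<le>m. sat (\<otimes>) (\<prec>) ?p ((?e i)(0 := x))" for m :: nat
  proof -
    obtain N :: nat where N: "b [^] m \<prec> a [^] N" using True by blast
    \<comment> \<open>Only for a positive exponent does noncommutation pass from \<open>a\<close> to
      \<open>a [^] N\<close>.\<close>
    have "N > 0" using N pow_le_pow[OF assms(2), of 0 m] by (cases N) auto
    then have "a [^] N \<otimes> b \<noteq> b \<otimes> a [^] N" using commute_pow assms(3) by blast
    moreover have "b [^] i \<prec> a [^] N" if "i \<le> m" for i
      using pow_le_pow[OF assms(2) that] N not_less_trans by blast
    ultimately show ?thesis by (intro exI[of _ "a [^] N"]) simp
  qed
  from realize_sequence[of "\<lambda>_. ?p" ?e, OF this]
  obtain a' where "a' \<otimes> b \<noteq> b \<otimes> a'" "\<And>i::nat. b [^] i \<prec> a'" by auto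
  then show ?thesis using dominated_pair_not_dp_small[OF assms(2)] by blast
next
  case False
  then obtain n :: nat where n: "\<And>N::nat. \<not> b [^] n \<prec> a [^] N" by blast
  have "a [^] i \<prec> b [^] Suc n" for i :: nat
    using n[of i] pow_less_pow[OF assms(2), of n "Suc n"] not_less_trans by blast
  moreover have "b [^] Suc n \<otimes> a \<noteq> a \<otimes> b [^] Suc n"
    using commute_pow[of "Suc n" b a] assms(3) by (metis zero_less_Suc)
  ultimately show ?thesis using dominated_pair_not_dp_small[OF assms(1)] by blast
qed

text \<open>An element and its inverse have the same centralizer, so \<open>a\<close> and
  \<open>b\<close> can be made positive one after the other.\<close>

lemma not_dp_small_if_noncommuting:
  assumes "a \<otimes> b \<noteq> b \<otimes> a"
  shows "\<not> dp_small (\<otimes>) (\<prec>)"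
proof -
  have inv_comm: "x \<otimes> y = y \<otimes> x" if "inv x \<otimes> y = y \<otimes> inv x" for x y
    by (metis that UNIV_I carrier_UNIV inv_solve_left m_assoc inv_closed inv_solve_right)
  have ne: "a \<noteq> \<one>" "b \<noteq> \<one>" using assms by auto
  have "\<exists>a'. \<one> \<prec> a' \<and> a' \<otimes> b \<noteq> b \<otimes> a'"
    using assms ne(1) inv_comm by (metis one_less_inv_iff total)
  then obtain a' where a': "\<one> \<prec> a'" "a' \<otimes> b \<noteq> b \<otimes> a'" by blast
  have "\<exists>b'. \<one> \<prec> b' \<and> a' \<otimes> b' \<noteq> b' \<otimes> a'"
    using a' ne(2) inv_comm by (metis one_less_inv_iff total)
  then show ?thesis using not_dp_small_if_noncommuting_pos a'(1) by blast
qed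

end

section \<open>Non-divisible groups\<close>

text \<open>Index shift: \<open>tpow n t\<close> denotes the power with exponent \<open>Suc n\<close>, as there is no term for \<open>\<one>\<close>.\<close>

fun tpow :: "nat \<Rightarrow> tm \<Rightarrow> tm" where
  "tpow 0 t = t"
| "tpow (Suc n) t = Pl (tpow n t) t"

lemma fvt_tpow [simp]: "fvt (tpow n t) = fvt t"
  by (induction n) auto

lemma (in ord_group) evalt_tpow [simp]: "evalt (\<otimes>) (tpow n t) e = evalt (\<otimes>) t e [^] Suc n"
  by (induction n) auto

text \<open>Here \<open>m - 1\<close> undoes the index shift of \<open>tpow\<close>, which is
  correct for \<open>m > 0\<close>.\<close>

definition divides_fm :: "nat \<Rightarrow> fm" where
  "divides_fm m = Ex 1 (Eq (tpow (m - 1) (V 1)) (V 0))"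

lemma (in ord_group) sat_divides_fm:
  "m > 0 \<Longrightarrow> sat (\<otimes>) (\<prec>) (divides_fm m) e \<longleftrightarrow> (\<exists>y. y [^] m = e 0)"
  by (cases m) (simp_all add: divides_fm_def)

locale comm_ord_group = ord_group +
  assumes comm: "x \<otimes> y = y \<otimes> x"
begin

sublocale comm_group G
  by unfold_locales (simp add: comm)

end

locale saturated_comm_ord_group = saturated_ord_group + comm_ord_group
begin

lemma not_dp_small_if_not_divisible_pos:
  assumes n: "n > 0" and g: "\<one> \<prec> g" "\<And>y. y [^] (n::nat) \<noteq> g"
  shows "\<not> dp_small (\<otimes>) (\<prec>)"
proof -
  have n2: "n > 1"
  proof (rule ccontr)
    assume "\<not> n > 1"
    then have "n = 1" using n by simp
    then have "g [^] n = g" by simp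
    then show False using g(2) by blast
  qed
  \<comment> \<open>The type of \<open>h\<close>: above all \<open>g [^] (n ^ i)\<close>, with a
    root of every order \<open>n ^ i\<close>. Its conditions up to \<open>m\<close> hold for
    \<open>g [^] (n ^ Suc m)\<close>.\<close>
  let ?p = "\<lambda>i. Conj (Lt (V 1) (V 0)) (divides_fm (n ^ i))"
  let ?e = "\<lambda>i k. g [^] (n ^ i :: nat)"
  have "\<exists>x. \<forall>i\<le>m. sat (\<otimes>) (\<prec>) (?p i) ((?e i)(0 := x))" for m :: nat
  proof (intro exI allI impI)
    fix i assume i: "i \<le> m"
    then have "n ^ i < n ^ Suc m" using n2 by (intro power_strict_increasing) auto
    then have 1: "g [^] (n ^ i) \<prec> g [^] (n ^ Suc m)" by (rule pow_less_pow[OF g(1)])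
    have "n ^ (Suc m - i) * n ^ i = n ^ Suc m" using i by (simp flip: power_add)
    then have "(g [^] (n ^ (Suc m - i))) [^] (n ^ i) = g [^] (n ^ Suc m)"
      using nat_pow_pow[of g "n ^ (Suc m - i)" "n ^ i"] by simp
    with 1 show "sat (\<otimes>) (\<prec>) (?p i) ((?e i)(0 := g [^] (n ^ Suc m)))"
      using n by (auto simp: sat_divides_fm simp del: power_Suc)
  qed
  from realize_sequence[of ?p ?e, OF this]
  obtain h where h: "\<And>i. g [^] (n ^ i) \<prec> h" "\<And>i. \<exists>w. w [^] (n ^ i) = h"
    using n by (auto simp: sat_divides_fm)
  \<comment> \<open>Since \<open>h [^] j\<close> has an \<open>n ^ i'\<close>-th root, only the
    roots of \<open>g [^] (n ^ i)\<close> matter.\<close>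
  have div_iff: "(\<exists>y. y [^] (n ^ i') = g [^] (n ^ i) \<otimes> h [^] j) \<longleftrightarrow> i' \<le> i" for i i' j :: nat
  proof
    obtain w where w: "w [^] (n ^ i') = h" using h(2) by blast
    have wj: "(w [^] j) [^] (n ^ i') = h [^] j"
      using nat_pow_pow[of w j "n ^ i'"] nat_pow_pow[of w "n ^ i'" j] w by (simp add: mult.commute)
    { assume "i' \<le> i"
      then have "n ^ (i - i') * n ^ i' = n ^ i" by (simp flip: power_add)
      then have "(g [^] (n ^ (i - i'))) [^] (n ^ i') = g [^] (n ^ i)"
        using nat_pow_pow[of g "n ^ (i - i')" "n ^ i'"] by simp
      then have "(g [^] (n ^ (i - i')) \<otimes> w [^] j) [^] (n ^ i') = g [^] (n ^ i) \<otimes> h [^] j"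
        using wj by (simp add: nat_pow_distrib)
      then show "\<exists>y. y [^] (n ^ i') = g [^] (n ^ i) \<otimes> h [^] j" by blast }
    assume "\<exists>y. y [^] (n ^ i') = g [^] (n ^ i) \<otimes> h [^] j"
    then obtain y where y: "y [^] (n ^ i') = g [^] (n ^ i) \<otimes> h [^] j" by blast
    define z where "z = y \<otimes> inv (w [^] j)"
    have "y = z \<otimes> w [^] j" by (simp add: z_def m_assoc)
    then have "z [^] (n ^ i') \<otimes> h [^] j = g [^] (n ^ i) \<otimes> h [^] j"
      using y wj by (simp add: nat_pow_distrib)
    then have z: "z [^] (n ^ i') = g [^] (n ^ i)" by simp
    show "i' \<le> i"
    proof (rule ccontr)
      assume "\<not> i' \<le> i"
      \<comment> \<open>Roots are unique, so the exponent \<open>n ^ i\<close> cancels and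
        \<open>z [^] (n ^ d)\<close> is an \<open>n\<close>-th root of \<open>g\<close>.\<close>
      then obtain d where d: "i' = Suc d + i" by (metis not_le less_iff_Suc_add add.commute add_Suc)
      have "(z [^] (n ^ Suc d)) [^] (n ^ i) = g [^] (n ^ i)"
        using z nat_pow_pow[of z "n ^ Suc d" "n ^ i"] d by (simp only: power_add) simp
      then have "z [^] (n ^ Suc d) = g" using pow_inj[of "n ^ i"] n by simp
      then have "(z [^] (n ^ d)) [^] n = g" using nat_pow_pow[of z "n ^ d" n] by (simp add: mult.commute)
      then show False using g(2) by blast
    qed
  qed
  show ?thesis
  proof (rule not_dp_smallI)
    fix i i' j :: nat
    show "sat (\<otimes>) (\<prec>) (Conj (divides_fm (n ^ i')) (Neg (divides_fm (n ^ Suc i'))))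
        ((\<lambda>_. g)(0 := g [^] (n ^ i) \<otimes> h [^] j)) \<longleftrightarrow> i' = i"
      using n div_iff[of i' i j] div_iff[of "Suc i'" i j]
      by (auto simp: sat_divides_fm simp del: power_Suc)
    show "\<not> g [^] (n ^ i) \<prec> \<one>" using pow_le_pow[OF g(1), of 0 "n ^ i"] by simp
    show "g [^] (n ^ i) \<prec> h" by (rule h)
  qed
qed

lemma not_dp_small_if_not_divisible:
  assumes n: "n > 0" and g: "\<And>y. y [^] (n::nat) \<noteq> g"
  shows "\<not> dp_small (\<otimes>) (\<prec>)"
proof -
  have "g \<noteq> \<one>" using g[of \<one>] by auto
  then consider "\<one> \<prec> g" | "\<one> \<prec> inv g" using total one_less_inv_iff by blast
  then show ?thesis
  proof cases
    case 2
    have "y [^] n \<noteq> inv g" for y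
      using g[of "inv y"] by (auto simp: nat_pow_inv)
    then show ?thesis using not_dp_small_if_not_divisible_pos n 2 by blast
  qed (use not_dp_small_if_not_divisible_pos n g in blast)
qed

end

section \<open>Divisible abelian groups\<close>

locale div_ord_group = comm_ord_group +
  assumes divisible: "n > 0 \<Longrightarrow> \<exists>y. y [^] (n::nat) = x"
    and nontrivial: "\<exists>x. x \<noteq> \<one>"
begin

section \<open>Order arithmetic, density and cuts\<close>

lemma inv_less_inv_iff: "inv x \<prec> inv y \<longleftrightarrow> y \<prec> x"
  using mult_less_left_iff[of y "inv x" "inv y"] mult_less_right_iff[of "y \<otimes> inv x" x \<one>]
  by (simp add: m_assoc)

lemma mult_inv_less_one_iff: "x \<otimes> inv y \<prec> \<one> \<longleftrightarrow> x \<prec> y"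
  using mult_less_right_iff[of "x \<otimes> inv y" y \<one>] by (simp add: m_assoc)

lemma one_less_mult_inv_iff: "\<one> \<prec> x \<otimes> inv y \<longleftrightarrow> y \<prec> x"
  using mult_less_right_iff[of \<one> y "x \<otimes> inv y"] by (simp add: m_assoc)

lemma int_pow_less_iff: "k > 0 \<Longrightarrow> x [^] (k::int) \<prec> y [^] k \<longleftrightarrow> x \<prec> y"
  using pow_less_iff[of "nat k" x y] by (metis int_pow_int nat_0_le order_less_imp_le zero_less_nat_eq)

lemma int_pow_less_iff_neg:
  assumes "k < 0"
  shows "x [^] (k::int) \<prec> y [^] k \<longleftrightarrow> y \<prec> x"
proof -
  have "x [^] k = inv (x [^] (- k))" for x using int_pow_neg[of x "- k"] by simp
  then show ?thesis using assms int_pow_less_iff[of "- k"] by (simp add: inv_less_inv_iff)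
qed

lemma dense: "x \<prec> y \<Longrightarrow> \<exists>z. x \<prec> z \<and> z \<prec> y"
proof -
  assume "x \<prec> y"
  obtain z where z: "z [^] (2::nat) = x \<otimes> y" using divisible[of 2] by auto
  have "x [^] (2::nat) \<prec> z [^] (2::nat)" "z [^] (2::nat) \<prec> y [^] (2::nat)"
    unfolding z using \<open>x \<prec> y\<close> by (simp_all add: numeral_2_eq_2)
  then show ?thesis using pow_less_iff[of 2] by auto
qed

lemma unbounded: "\<exists>y. x \<prec> y" "\<exists>y. y \<prec> x"
proof -
  obtain p where p: "\<one> \<prec> p" using nontrivial total one_less_inv_iff by metis
  show "\<exists>y. x \<prec> y" using mult_less_left[OF p, of x] by auto
  show "\<exists>y. y \<prec> x" using mult_less_left[OF p, of "x \<otimes> inv p"] by (auto simp: m_assoc)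
qed

text \<open>Density fills the gap between \<open>Max A\<close> and \<open>Min B\<close>;
  unboundedness covers an empty side.\<close>

lemma between_finite:
  assumes "finite A" "finite B" "\<And>a b. a \<in> A \<Longrightarrow> b \<in> B \<Longrightarrow> a \<prec> b"
  shows "\<exists>x. (\<forall>a\<in>A. a \<prec> x) \<and> (\<forall>b\<in>B. x \<prec> b)"
proof -
  interpret ord: linorder "\<lambda>x y. x \<prec> y \<or> x = y" "(\<prec>)"
    by unfold_locales (use trans total irrefl in blast)+
  have above: "\<exists>x. (\<forall>a\<in>A. a \<prec> x) \<and> x \<prec> y" if "\<forall>a\<in>A. a \<prec> y" for y
  proof (cases "A = {}")
    case False
    with that obtain x where "ord.Max A \<prec> x" "x \<prec> y"
      using dense ord.Max_in[OF assms(1)] by blast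
    then show ?thesis using ord.Max_ge[OF assms(1)] trans by blast
  qed (use unbounded in auto)
  have ub: "\<exists>x. \<forall>a\<in>A. a \<prec> x"
  proof (cases "A = {}")
    case False
    obtain x where "ord.Max A \<prec> x" using unbounded by blast
    then show ?thesis using ord.Max_ge[OF assms(1)] trans by blast
  qed auto
  show ?thesis
  proof (cases "B = {}")
    case False
    have "\<forall>a\<in>A. a \<prec> ord.Min B" using assms(3) ord.Min_in[OF assms(2) False] by blast
    then obtain x where "\<forall>a\<in>A. a \<prec> x" "x \<prec> ord.Min B" using above by blast
    then show ?thesis using ord.Min_le[OF assms(2)] trans by blast
  qed (use ub in auto)
qed

text \<open>A back-and-forth step: if \<open>x\<close> is some \<open>c i\<close>, the answer is
  \<open>c' i\<close>; otherwise \<open>between_finite\<close> fills the corresponding gap.\<close>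

lemma same_cut:
  assumes "finite I" and iso: "\<And>i j. i \<in> I \<Longrightarrow> j \<in> I \<Longrightarrow> c i \<prec> c j \<longleftrightarrow> c' i \<prec> c' j"
  shows "\<exists>y. \<forall>i\<in>I. (x \<prec> c i \<longleftrightarrow> y \<prec> c' i) \<and> (c i \<prec> x \<longleftrightarrow> c' i \<prec> y)"
proof (cases "\<exists>i\<in>I. c i = x")
  case True
  then show ?thesis using iso by blast
next
  case False
  have "c' i \<prec> c' j" if "i \<in> I" "j \<in> I" "c i \<prec> x" "x \<prec> c j" for i j
    using iso[of i j] trans[of "c i" x "c j"] that by blast
  then have "\<exists>y. (\<forall>a\<in>c' ` {i\<in>I. c i \<prec> x}. a \<prec> y) \<and> (\<forall>b\<in>c' ` {i\<in>I. x \<prec> c i}. y \<prec> b)"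
    using assms(1) by (intro between_finite) auto
  then obtain y where y: "\<And>i. i \<in> I \<Longrightarrow> c i \<prec> x \<Longrightarrow> c' i \<prec> y"
    "\<And>i. i \<in> I \<Longrightarrow> x \<prec> c i \<Longrightarrow> y \<prec> c' i" by auto
  have "(x \<prec> c i \<longleftrightarrow> y \<prec> c' i) \<and> (c i \<prec> x \<longleftrightarrow> c' i \<prec> y)" if "i \<in> I" for i
    using y[OF that] False total[of "c i" x] asym that by blast
  then show ?thesis by blast
qed

section \<open>Integer linear forms in the variables, written multiplicatively\<close>

inductive_set forms :: "((nat \<Rightarrow> 'a) \<Rightarrow> 'a) set" where
  var: "(\<lambda>e. e n) \<in> forms"
| mult: "f \<in> forms \<Longrightarrow> g \<in> forms \<Longrightarrow> (\<lambda>e. f e \<otimes> g e) \<in> forms"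
| int_pow: "f \<in> forms \<Longrightarrow> (\<lambda>e. f e [^] (k::int)) \<in> forms"

lemma forms_one: "(\<lambda>e. \<one>) \<in> forms"
  using forms.int_pow[OF forms.var, of undefined 0] by simp

lemma forms_inv: "f \<in> forms \<Longrightarrow> (\<lambda>e. inv (f e)) \<in> forms"
  using forms.int_pow[of f "- 1"] by (simp add: int_pow_neg)

lemma forms_evalt: "evalt (\<otimes>) t \<in> forms"
  by (induction t) (auto intro: forms.intros)

text \<open>Commutativity collects the occurrences of variable \<open>n\<close>; as the equation
  holds for all \<open>e\<close> and \<open>a\<close>, the cofactor \<open>g\<close> does not depend
  on \<open>e n\<close>.\<close>

lemma forms_split:
  "f \<in> forms \<Longrightarrow> \<exists>k::int. \<exists>g\<in>forms. \<forall>e a. f (e(n := a)) = a [^] k \<otimes> g e"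
proof (induction rule: forms.induct)
  case (var m)
  show ?case
  proof (cases "m = n")
    case True
    then show ?thesis by (intro exI[of _ 1] bexI[OF _ forms_one]) simp
  next
    case False
    then show ?thesis by (intro exI[of _ 0] bexI[OF _ forms.var[of m]]) simp
  qed
next
  case (mult f f')
  then obtain k g k' g' where *: "g \<in> forms" "\<And>e a. f (e(n := a)) = a [^] (k::int) \<otimes> g e"
    "g' \<in> forms" "\<And>e a. f' (e(n := a)) = a [^] (k'::int) \<otimes> g' e" by metis
  have "a [^] k \<otimes> g e \<otimes> (a [^] k' \<otimes> g' e) = a [^] (k + k') \<otimes> (g e \<otimes> g' e)" for a e
    by (simp add: int_pow_mult m_ac)
  with * show ?case
    by (intro exI[of _ "k + k'"] bexI[OF _ forms.mult[OF *(1,3)]]) (simp del: fun_upd_apply)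
next
  case (int_pow f j)
  then obtain k g where *: "g \<in> forms" "\<And>e a. f (e(n := a)) = a [^] (k::int) \<otimes> g e" by metis
  then show ?case
    by (intro exI[of _ "k * j"] bexI[OF _ forms.int_pow[OF *(1), of j]])
      (simp add: int_pow_distrib int_pow_pow del: fun_upd_apply)
qed

section \<open>Quantifier elimination by signs of forms, and convexity\<close>

definition same_sign :: "'a \<Rightarrow> 'a \<Rightarrow> bool" where
  "same_sign x y \<longleftrightarrow> (x \<prec> \<one> \<longleftrightarrow> y \<prec> \<one>) \<and> (\<one> \<prec> x \<longleftrightarrow> \<one> \<prec> y)"

text \<open>Quantifier elimination in semantic form: for finite \<open>\<Lambda>\<close>, the
  formula is equivalent to a Boolean combination of sign conditions on
  \<open>\<Lambda>\<close>.\<close>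

definition determines :: "((nat \<Rightarrow> 'a) \<Rightarrow> 'a) set \<Rightarrow> fm \<Rightarrow> bool" where
  "determines \<Lambda> \<phi> \<longleftrightarrow> (\<forall>e e'. (\<forall>f\<in>\<Lambda>. same_sign (f e) (f e')) \<longrightarrow>
     sat (\<otimes>) (\<prec>) \<phi> e = sat (\<otimes>) (\<prec>) \<phi> e')"

text \<open>Raising to the power \<open>m\<close> keeps or reverses signs according to the sign of
  \<open>m\<close>, and leaves \<open>a [^] K\<close> to be compared with a threshold free of
  \<open>a\<close>.\<close>

lemma sign_via_root:
  assumes "k \<noteq> 0" "k * m = K" "K > (0::int)"
  shows "a [^] k \<otimes> g \<prec> \<one> \<longleftrightarrow> (if m > 0 then a [^] K \<prec> g [^] (- m) else g [^] (- m) \<prec> a [^] K)"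
    and "\<one> \<prec> a [^] k \<otimes> g \<longleftrightarrow> (if m > 0 then g [^] (- m) \<prec> a [^] K else a [^] K \<prec> g [^] (- m))"
proof -
  have m: "m > 0 \<or> m < 0" using assms by (metis less_irrefl linorder_neqE mult_zero_right)
  have pw: "(a [^] k \<otimes> g) [^] m = a [^] K \<otimes> g [^] m"
    using assms(2) by (simp add: int_pow_distrib int_pow_pow)
  have gm: "g [^] (- m) = inv (g [^] m)" by (simp add: int_pow_neg)
  have 1: "a [^] K \<otimes> g [^] m \<prec> \<one> \<longleftrightarrow> a [^] K \<prec> g [^] (- m)"
    using mult_inv_less_one_iff[of "a [^] K" "inv (g [^] m)"] gm by simp
  have 2: "\<one> \<prec> a [^] K \<otimes> g [^] m \<longleftrightarrow> g [^] (- m) \<prec> a [^] K"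
    using one_less_mult_inv_iff[of "a [^] K" "inv (g [^] m)"] gm by simp
  show "a [^] k \<otimes> g \<prec> \<one> \<longleftrightarrow> (if m > 0 then a [^] K \<prec> g [^] (- m) else g [^] (- m) \<prec> a [^] K)"
    using m int_pow_less_iff[of m "a [^] k \<otimes> g" \<one>] int_pow_less_iff_neg[of m \<one> "a [^] k \<otimes> g"] pw 1 2
    by auto
  show "\<one> \<prec> a [^] k \<otimes> g \<longleftrightarrow> (if m > 0 then g [^] (- m) \<prec> a [^] K else a [^] K \<prec> g [^] (- m))"
    using m int_pow_less_iff[of m \<one> "a [^] k \<otimes> g"] int_pow_less_iff_neg[of m "a [^] k \<otimes> g" \<one>] pw 1 2
    by auto
qed

text \<open>After raising all forms to suitable powers, the eliminated variable occurs in them only as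
  \<open>a [^] K\<close>, so only its position relative to finitely many roots matters, and the comparisons
  between the roots are again signs of forms.\<close>

lemma determines_Ex:
  assumes "finite \<Lambda>" "\<Lambda> \<subseteq> forms" "determines \<Lambda> \<phi>"
  shows "\<exists>\<Lambda>'. finite \<Lambda>' \<and> \<Lambda>' \<subseteq> forms \<and> determines \<Lambda>' (Ex n \<phi>)"
proof -
  have "\<forall>f\<in>\<Lambda>. \<exists>k::int. \<exists>g. g \<in> forms \<and> (\<forall>e a. f (e(n := a)) = a [^] k \<otimes> g e)"
    using forms_split assms(2) by blast
  then obtain k :: "_ \<Rightarrow> int" and g where g: "\<And>f. f \<in> \<Lambda> \<Longrightarrow> g f \<in> forms"
    and split: "\<And>f e a. f \<in> \<Lambda> \<Longrightarrow> f (e(n := a)) = a [^] k f \<otimes> g f e"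
    by metis
  \<comment> \<open>A common multiple of the nonzero exponents; the empty product gives 1.\<close>
  define K where "K = (\<Prod>f\<in>{f\<in>\<Lambda>. k f \<noteq> 0}. \<bar>k f\<bar>)"
  have K: "K > 0" unfolding K_def by (intro prod_pos) auto
  have dvd: "k f * (K div k f) = K" if "f \<in> \<Lambda>" "k f \<noteq> 0" for f
  proof -
    have "\<bar>k f\<bar> dvd K" unfolding K_def using that assms(1) by (intro dvd_prodI) auto
    then show ?thesis by simp
  qed
  \<comment> \<open>The threshold for \<open>a [^] K\<close>; for \<open>k f = 0\<close> the
    division by zero makes it constantly \<one>, which is harmless.\<close>
  define r where "r f = (\<lambda>e. g f e [^] (- (K div k f)))" for f
  have r: "r f \<in> forms" if "f \<in> \<Lambda>" for f
    unfolding r_def using g[OF that] by (rule forms.int_pow)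
  \<comment> \<open>The forms \<open>g f\<close> settle the case \<open>k f = 0\<close>; the
    quotients fix the order of the thresholds.\<close>
  let ?\<Lambda>' = "g ` \<Lambda> \<union> (\<lambda>(f, h) e. r f e \<otimes> inv (r h e)) ` (\<Lambda> \<times> \<Lambda>)"
  have imp: "sat (\<otimes>) (\<prec>) (Ex n \<phi>) e'"
    if same: "\<forall>f\<in>?\<Lambda>'. same_sign (f e) (f e')" and sat: "sat (\<otimes>) (\<prec>) (Ex n \<phi>) e" for e e'
  proof -
    obtain a where a: "sat (\<otimes>) (\<prec>) \<phi> (e(n := a))" using sat by auto
    have "r f e \<prec> r h e \<longleftrightarrow> r f e' \<prec> r h e'" if "f \<in> \<Lambda>" "h \<in> \<Lambda>" for f h
    proof -
      have "same_sign (r f e \<otimes> inv (r h e)) (r f e' \<otimes> inv (r h e'))"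
        using bspec[OF same, of "\<lambda>e. r f e \<otimes> inv (r h e)"] that by force
      then show ?thesis by (simp add: same_sign_def mult_inv_less_one_iff)
    qed
    then obtain b where b: "\<And>f. f \<in> \<Lambda> \<Longrightarrow> (a [^] K \<prec> r f e \<longleftrightarrow> b \<prec> r f e')"
      "\<And>f. f \<in> \<Lambda> \<Longrightarrow> (r f e \<prec> a [^] K \<longleftrightarrow> r f e' \<prec> b)"
      using same_cut[OF assms(1), of "\<lambda>f. r f e" "\<lambda>f. r f e'" "a [^] K"] by blast
    \<comment> \<open>The cut only prescribes the \<open>K\<close>-th power \<open>b\<close>;
      divisibility gives the value of the variable itself.\<close>
    obtain a' where "a' [^] nat K = b" using divisible[of "nat K" b] K by auto
    then have a': "a' [^] K = b" using K by (metis int_pow_int nat_0_le order_less_imp_le)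
    have "same_sign (f (e(n := a))) (f (e'(n := a')))" if f: "f \<in> \<Lambda>" for f
    proof (cases "k f = 0")
      case True
      then show ?thesis using same f by (simp add: split)
    next
      case False
      show ?thesis unfolding same_sign_def split[OF f]
          sign_via_root[OF False dvd[OF f False] K] a'
        using b[OF f] by (auto simp: r_def)
    qed
    then have "sat (\<otimes>) (\<prec>) \<phi> (e'(n := a'))"
      using assms(3) a unfolding determines_def by blast
    then show ?thesis by auto
  qed
  have "determines ?\<Lambda>' (Ex n \<phi>)"
    unfolding determines_def
  proof (intro allI impI)
    fix e e' assume *: "\<forall>f\<in>?\<Lambda>'. same_sign (f e) (f e')"
    then have "\<forall>f\<in>?\<Lambda>'. same_sign (f e') (f e)" unfolding same_sign_def by blast
    with * imp show "sat (\<otimes>) (\<prec>) (Ex n \<phi>) e = sat (\<otimes>) (\<prec>) (Ex n \<phi>) e'" by blast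
  qed
  moreover have "?\<Lambda>' \<subseteq> forms" using g forms.mult[OF r forms_inv[OF r]] by auto
  moreover have "finite ?\<Lambda>'" using assms(1) by simp
  ultimately show ?thesis by blast
qed

text \<open>An atom is decided by the sign of the quotient of its sides; \<open>Conj\<close> takes a
  union, and \<open>determines_Ex\<close> handles the quantifier.\<close>

lemma ex_determines: "\<exists>\<Lambda>. finite \<Lambda> \<and> \<Lambda> \<subseteq> forms \<and> determines \<Lambda> \<phi>"
proof (induction \<phi>)
  case (Eq s t)
  have "(\<lambda>e. evalt (\<otimes>) s e \<otimes> inv (evalt (\<otimes>) t e)) \<in> forms"
    by (intro forms.mult forms_inv forms_evalt)
  moreover have "determines {\<lambda>e. evalt (\<otimes>) s e \<otimes> inv (evalt (\<otimes>) t e)} (Eq s t)"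
    unfolding determines_def same_sign_def
    by (simp add: mult_inv_less_one_iff one_less_mult_inv_iff) (metis total irrefl)
  ultimately show ?case by blast
next
  case (Lt s t)
  have "(\<lambda>e. evalt (\<otimes>) s e \<otimes> inv (evalt (\<otimes>) t e)) \<in> forms"
    by (intro forms.mult forms_inv forms_evalt)
  moreover have "determines {\<lambda>e. evalt (\<otimes>) s e \<otimes> inv (evalt (\<otimes>) t e)} (Lt s t)"
    unfolding determines_def same_sign_def by (simp add: mult_inv_less_one_iff)
  ultimately show ?case by blast
next
  case (Neg \<phi>)
  then show ?case unfolding determines_def by simp
next
  case (Conj \<phi> \<chi>)
  then obtain A B where "finite A" "A \<subseteq> forms" "determines A \<phi>" "finite B" "B \<subseteq> forms" "determines B \<chi>"
    by blast
  then show ?case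
    by (intro exI[of _ "A \<union> B"]) (simp add: determines_def ball_Un, blast)
next
  case (Ex n \<phi>)
  then show ?case using determines_Ex by blast
qed

text \<open>The map \<open>P\<close> below counts sign changes of forms to the left of a point: definable sets have
  uniformly boundedly many convex components.\<close>

lemma ex_monotone_classifier:
  "\<exists>N::nat. \<forall>e. \<exists>P::'a \<Rightarrow> nat. (\<forall>a. P a \<le> N) \<and> (\<forall>a b. a \<prec> b \<longrightarrow> P a \<le> P b) \<and>
     (\<forall>a b. P a = P b \<longrightarrow> sat (\<otimes>) (\<prec>) \<phi> (e(0 := a)) = sat (\<otimes>) (\<prec>) \<phi> (e(0 := b)))"
proof -
  obtain \<Lambda> where \<Lambda>: "finite \<Lambda>" "\<Lambda> \<subseteq> forms" "determines \<Lambda> \<phi>" using ex_determines by blast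
  have "\<forall>f\<in>\<Lambda>. \<exists>k::int. \<exists>g. \<forall>e a. f (e(0 := a)) = a [^] k \<otimes> g e"
    using forms_split \<Lambda>(2) by blast
  then obtain k :: "_ \<Rightarrow> int" and g where split: "\<And>f e a. f \<in> \<Lambda> \<Longrightarrow> f (e(0 := a)) = a [^] k f \<otimes> g f e"
    by metis
  define sg :: "'a \<Rightarrow> nat" where "sg x = (if x \<prec> \<one> then 0 else if \<one> \<prec> x then 2 else 1)" for x
  have sg_mono: "sg x \<le> sg y" if "x \<prec> y \<or> x = y" for x y
    using that trans[of x y \<one>] trans[of \<one> x y] unfolding sg_def by auto
  have sg_same: "same_sign x y" if "sg x = sg y" for x y
    using that asym[of x \<one>] asym[of y \<one>] unfolding sg_def same_sign_def by (auto split: if_splits)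
  \<comment> \<open>For a negative exponent the sign falls as \<open>a\<close> grows; the flip
    \<open>2 - sg\<close> makes every \<open>s e a f\<close> monotone in \<open>a\<close>.\<close>
  define s where "s e a f = (if k f \<ge> 0 then sg (f (e(0 := a))) else 2 - sg (f (e(0 := a))))" for e a f
  have sg2: "sg x \<le> 2" for x by (simp add: sg_def)
  have s2: "s e a f \<le> 2" for e a f using sg2 by (simp add: s_def)
  have s_mono: "s e a f \<le> s e b f" if "f \<in> \<Lambda>" "a \<prec> b" for e a b f
  proof (cases "k f \<ge> 0")
    case True
    then have "a [^] k f \<prec> b [^] k f \<or> a [^] k f = b [^] k f"
      using int_pow_less_iff[of "k f" a b] that(2) by (cases "k f = 0") auto
    then have "f (e(0 := a)) \<prec> f (e(0 := b)) \<or> f (e(0 := a)) = f (e(0 := b))"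
      unfolding split[OF that(1)] by auto
    then show ?thesis using True sg_mono by (simp add: s_def)
  next
    case False
    then have "b [^] k f \<prec> a [^] k f"
      using int_pow_less_iff_neg[of "k f" b a] that(2) by simp
    then have "f (e(0 := b)) \<prec> f (e(0 := a))"
      unfolding split[OF that(1)] by auto
    then show ?thesis using False sg_mono by (simp add: s_def diff_le_mono2)
  qed
  \<comment> \<open>The summands are monotone, so equal sums force equal summands, hence equal
    signs.\<close>
  have s_eq: "sat (\<otimes>) (\<prec>) \<phi> (e(0 := a)) = sat (\<otimes>) (\<prec>) \<phi> (e(0 := b))"
    if "a \<prec> b" "sum (s e a) \<Lambda> = sum (s e b) \<Lambda>" for e a b
  proof -
    have "same_sign (f (e(0 := a))) (f (e(0 := b)))" if f: "f \<in> \<Lambda>" for f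
    proof (rule sg_same)
      have "s e a f = s e b f"
        using sum_mono_inv[OF \<open>sum (s e a) \<Lambda> = sum (s e b) \<Lambda>\<close> s_mono f \<Lambda>(1)] \<open>a \<prec> b\<close> by blast
      then show "sg (f (e(0 := a))) = sg (f (e(0 := b)))"
        using sg2[of "f (e(0 := a))"] sg2[of "f (e(0 := b))"] by (auto simp: s_def split: if_splits)
    qed
    then show ?thesis using \<Lambda>(3) unfolding determines_def by blast
  qed
  show ?thesis
  proof (intro exI allI conjI impI)
    \<comment> \<open>Each summand is at most 2, so the bound does not depend on the parameters
      \<open>e\<close>.\<close>
    fix e a show "sum (s e a) \<Lambda> \<le> card \<Lambda> * 2"
      using sum_bounded_above[of \<Lambda> "s e a" 2] s2 by simp
  next
    fix e a b assume "a \<prec> b"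
    then show "sum (s e a) \<Lambda> \<le> sum (s e b) \<Lambda>" using s_mono by (intro sum_mono)
  next
    fix e a b assume "sum (s e a) \<Lambda> = sum (s e b) \<Lambda>"
    then show "sat (\<otimes>) (\<prec>) \<phi> (e(0 := a)) = sat (\<otimes>) (\<prec>) \<phi> (e(0 := b))"
      using s_eq[of a b e] s_eq[of b a e] total[of a b] by auto
  qed
qed

section \<open>The pigeonhole argument against arrays\<close>

lemma no_array:
  assumes "\<And>i j i' :: nat. sat (\<otimes>) (\<prec>) (\<phi> i') ((c i')(0 := x i j)) \<longleftrightarrow> i' = i"
    and "\<And>i j j' :: nat. sat (\<otimes>) (\<prec>) \<psi> ((b j')(0 := x i j)) \<longleftrightarrow> j' = j"
  shows False
proof -
  obtain N Q where Q: "\<And>e a. Q e a \<le> (N::nat)" "\<And>e a b. a \<prec> b \<Longrightarrow> Q e a \<le> Q e b"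
    "\<And>e a b. Q e a = Q e b \<Longrightarrow> sat (\<otimes>) (\<prec>) \<psi> (e(0 := a)) = sat (\<otimes>) (\<prec>) \<psi> (e(0 := b))"
    using ex_monotone_classifier[of \<psi>] by metis
  have "\<exists>N P. (\<forall>a. P a \<le> (N::nat)) \<and> (\<forall>a b. a \<prec> b \<longrightarrow> P a \<le> P b) \<and>
    (\<forall>a b. P a = P b \<longrightarrow> sat (\<otimes>) (\<prec>) (\<phi> i) ((c i)(0 := a)) = sat (\<otimes>) (\<prec>) (\<phi> i) ((c i)(0 := b)))" for i
    using ex_monotone_classifier[of "\<phi> i"] by metis
  then obtain L P where P: "\<And>i a. P i a \<le> (L i::nat)" "\<And>i a b. a \<prec> b \<Longrightarrow> P i a \<le> P i b"
    "\<And>i a b. P i a = P i b \<Longrightarrow> sat (\<otimes>) (\<prec>) (\<phi> i) ((c i)(0 := a)) = sat (\<otimes>) (\<prec>) (\<phi> i) ((c i)(0 := b))"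
    by metis
  \<comment> \<open>\<open>Q\<close> takes at most \<open>N + 1\<close> values, so
    \<open>N + 2\<close> rows force a coincidence in each column.\<close>
  define M where "M = N + 2"
  \<comment> \<open>A monotone label for the joint convex pieces of the first \<open>M\<close> row
    formulas: equal sums force all \<open>P i\<close> to agree.\<close>
  define R where "R a = (\<Sum>i<M. P i a)" for a
  have R_le: "R a \<le> (\<Sum>i<M. L i)" for a unfolding R_def using P(1) by (intro sum_mono)
  have R_mono: "R a \<le> R b" if "a \<prec> b" for a b unfolding R_def using P(2)[OF that] by (intro sum_mono)
  have R_eq: "P i a = P i b" if "R a = R b" "i < M" for a b i
  proof -
    have *: "P i a = P i b" if "R a = R b" "a \<prec> b" for a b
      using sum_mono_inv[of "\<lambda>i. P i a" "{..<M}" "\<lambda>i. P i b" i] that P(2)[OF that(2)] \<open>i < M\<close>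
      by (simp add: R_def)
    show ?thesis using *[of a b] *[of b a] total[of a b] that by auto
  qed
  \<comment> \<open>Row formula \<open>i\<close> separates the two points, so their labels differ
    and can be ordered.\<close>
  have R_ne: "R (x i j) \<noteq> R (x i' j)" if "i < M" "i \<noteq> i'" for i i' j
    using P(3)[of i "x i j" "x i' j"] R_eq[of "x i j" "x i' j" i] assms(1)[of i i j] assms(1)[of i i' j] that
    by blast
  have "\<exists>i i'. i < M \<and> i' < M \<and> R (x i j) < R (x i' j) \<and> Q (b j) (x i j) = Q (b j) (x i' j)" for j
  proof -
    have "(\<lambda>i. Q (b j) (x i j)) ` {..<M} \<subseteq> {..N}" using Q(1) by auto
    from card_mono[OF finite_atMost this]
    have "card ((\<lambda>i. Q (b j) (x i j)) ` {..<M}) < card {..<M}" by (simp add: M_def)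
    from pigeonhole[OF this] obtain i i' where
      ii: "i < M" "i' < M" "i \<noteq> i'" "Q (b j) (x i j) = Q (b j) (x i' j)"
      unfolding inj_on_def by auto
    from R_ne[OF ii(1,3), of j] consider "R (x i j) < R (x i' j)" | "R (x i' j) < R (x i j)"
      by linarith
    then show ?thesis using ii by cases (blast, metis)
  qed
  then obtain u v where uv: "\<And>j. u j < M" "\<And>j. v j < M" "\<And>j. R (x (u j) j) < R (x (v j) j)"
    "\<And>j. Q (b j) (x (u j) j) = Q (b j) (x (v j) j)" by metis
  \<comment> \<open>There are finitely many keys, so two columns share their pair of rows and both
    labels.\<close>
  define key where "key j = (u j, v j, R (x (u j) j), R (x (v j) j))" for j
  have "range key \<subseteq> {..<M} \<times> {..<M} \<times> {..\<Sum>i<M. L i} \<times> {..\<Sum>i<M. L i}"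
    using uv R_le by (auto simp: key_def)
  then have "finite (range key)" by (rule finite_subset) simp
  then have "\<not> inj key" using finite_imageD infinite_UNIV_nat by blast
  then obtain j j' where jj: "j \<noteq> j'" "key j = key j'" unfolding inj_on_def by blast
  \<comment> \<open>The point \<open>x (u j) j'\<close> is not below \<open>x (u j) j\<close>, and
    its label puts it below \<open>x (v j) j\<close>. As \<open>Q (b j)\<close> agrees at both ends,
    it agrees in between, so the \<open>j\<close>-th instance of \<open>\<psi>\<close> holds in
    column \<open>j'\<close>.\<close>
  have contra: False if "j \<noteq> j'" "key j = key j'" "\<not> x (u j) j' \<prec> x (u j) j" for j j'
  proof -
    have k: "u j' = u j" "R (x (u j) j') = R (x (u j) j)"
      using that(2) by (auto simp: key_def)
    have "R (x (u j) j') < R (x (v j) j)" using k(2) uv(3)[of j] by simp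
    then have 1: "x (u j) j' \<prec> x (v j) j"
      using R_mono[of "x (v j) j" "x (u j) j'"] total[of "x (v j) j" "x (u j) j'"] by auto
    have "Q (b j) (x (u j) j) \<le> Q (b j) (x (u j) j')"
      using that(3) total[of "x (u j) j" "x (u j) j'"] Q(2) by auto
    then have "Q (b j) (x (u j) j') = Q (b j) (x (u j) j)"
      using Q(2)[OF 1, of "b j"] uv(4)[of j] by simp
    then have "sat (\<otimes>) (\<prec>) \<psi> ((b j)(0 := x (u j) j'))"
      using Q(3) assms(2)[of j "u j" j] by blast
    then show False using assms(2)[of j "u j" j'] that(1) by simp
  qed
  have "u j' = u j" using jj(2) by (simp add: key_def)
  \<comment> \<open>By asymmetry at least one of the two columns can serve as \<open>j\<close>
    above.\<close>
  then have "\<not> x (u j) j' \<prec> x (u j) j \<or> \<not> x (u j') j \<prec> x (u j') j'" using asym by metis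
  then show False using contra jj by metis
qed

end

section \<open>Transfer to the monster model\<close>

abbreviation (input) Imp :: "fm \<Rightarrow> fm \<Rightarrow> fm" where
  "Imp \<phi> \<chi> \<equiv> Neg (Conj \<phi> (Neg \<chi>))"

abbreviation (input) All :: "nat \<Rightarrow> fm \<Rightarrow> fm" where
  "All n \<phi> \<equiv> Neg (Ex n (Neg \<phi>))"

lemma models_ThD:
  fixes pl :: "'m \<Rightarrow> 'm \<Rightarrow> 'm"
  assumes "models_Th TYPE('g::{plus,ord}) pl ls" "fv \<phi> = {}" "\<And>e::nat \<Rightarrow> 'g. sat (+) (<) \<phi> e"
  shows "sat pl ls \<phi> e"
  using assms unfolding models_Th_def by blast

lemma models_ord_group:
  fixes pl :: "'m \<Rightarrow> 'm \<Rightarrow> 'm"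
  assumes ord: "ordered_grp TYPE('g::{group_add,linorder})" and M: "models_Th TYPE('g) pl ls"
  shows "\<exists>z. ord_group \<lparr>carrier = UNIV, mult = pl, one = z\<rparr> ls"
proof -
  note tr = models_ThD[OF M, where e = undefined]
  have assoc: "pl (pl x y) z = pl x (pl y z)" for x y z
    using tr[of "All 0 (All 1 (All 2 (Eq (Pl (Pl (V 0) (V 1)) (V 2)) (Pl (V 0) (Pl (V 1) (V 2))))))"]
    by (simp add: add.assoc)
  \<comment> \<open>The language has no symbol for the identity, so one existential sentence asserts
    identity and left inverses together; its witness becomes the unit.\<close>
  have "\<exists>z :: 'g. \<forall>x. z + x = x \<and> (\<exists>y. y + x = z)"
    by (intro exI[of _ 0]) (auto intro: left_minus)
  then have "\<exists>z. \<forall>x. pl z x = x \<and> (\<exists>y. pl y x = z)"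
    using tr[of "Ex 0 (All 1 (Conj (Eq (Pl (V 0) (V 1)) (V 1)) (Ex 2 (Eq (Pl (V 2) (V 1)) (V 0)))))"]
    by (simp, blast)
  then obtain z where z: "\<And>x. pl z x = x" "\<And>x. \<exists>y. pl y x = z" by blast
  have irrefl: "\<not> ls x x" for x
    using tr[of "All 0 (Neg (Lt (V 0) (V 0)))"] by simp
  have trans: "ls x y \<Longrightarrow> ls y z \<Longrightarrow> ls x z" for x y z
    using tr[of "All 0 (All 1 (All 2 (Imp (Lt (V 0) (V 1)) (Imp (Lt (V 1) (V 2)) (Lt (V 0) (V 2))))))"]
    by simp (blast intro: less_trans)
  have total: "ls x y \<or> x = y \<or> ls y x" for x y
    using tr[of "All 0 (All 1 (Imp (Neg (Lt (V 0) (V 1))) (Imp (Neg (Eq (V 0) (V 1))) (Lt (V 1) (V 0)))))"]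
    by (simp add: linorder_less_linear) blast
  have mono: "ls x y \<Longrightarrow> ls (pl z x) (pl z y) \<and> ls (pl x z) (pl y z)" for x y z
    using tr[of "All 0 (All 1 (All 2 (Imp (Lt (V 0) (V 1))
      (Conj (Lt (Pl (V 2) (V 0)) (Pl (V 2) (V 1))) (Lt (Pl (V 0) (V 2)) (Pl (V 1) (V 2)))))))"]
      ord[unfolded ordered_grp_def]
    by simp blast
  interpret group "\<lparr>carrier = UNIV, mult = pl, one = z\<rparr>"
    by (rule groupI) (use assoc z in auto)
  have "ord_group \<lparr>carrier = UNIV, mult = pl, one = z\<rparr> ls"
    by unfold_locales (use irrefl trans total mono in \<open>auto | blast\<close>)
  then show ?thesis by blast
qed

lemma evalt_plus_tpow: "evalt (+) (tpow n t) e = nmul (Suc n) (evalt (+) t e)"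
  by (induction n) (simp_all add: nmul_def)

theorem theorem1p6:
  fixes pl :: "'m \<Rightarrow> 'm \<Rightarrow> 'm" and ls :: "'m \<Rightarrow> 'm \<Rightarrow> bool"
  assumes "ordered_grp TYPE('g::{group_add,linorder})"
    and "infinite (UNIV :: 'g set)"
    and "monster TYPE('g) pl ls"
  shows "dp_small pl ls \<longleftrightarrow> abelian_grp TYPE('g) \<and> divisible_grp TYPE('g)"
proof -
  have M: "models_Th TYPE('g) pl ls"
    and sat: "\<forall>P. countable P \<and> consistent pl ls P \<longrightarrow> (\<exists>a. realizes pl ls a P)"
    using assms(3) unfolding monster_def by auto
  note tr = models_ThD[OF M, where e = undefined]
  obtain z where "ord_group \<lparr>carrier = UNIV, mult = pl, one = z\<rparr> ls"
    using models_ord_group[OF assms(1) M] by blast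
  then interpret ord_group "\<lparr>carrier = UNIV, mult = pl, one = z\<rparr>" ls .
  interpret saturated_ord_group "\<lparr>carrier = UNIV, mult = pl, one = z\<rparr>" ls
    by unfold_locales (use sat in simp)
  let ?G = "\<lparr>carrier = UNIV, mult = pl, one = z\<rparr>"
  show ?thesis
  proof (cases "abelian_grp TYPE('g)")
    case False
    then have "\<exists>x y. pl x y \<noteq> pl y x"
      using tr[of "Ex 0 (Ex 1 (Neg (Eq (Pl (V 0) (V 1)) (Pl (V 1) (V 0)))))"]
      by (simp add: abelian_grp_def) blast
    then show ?thesis using not_dp_small_if_noncommuting False by auto
  next
    case True
    then have comm: "pl x y = pl y x" for x y
      using tr[of "All 0 (All 1 (Eq (Pl (V 0) (V 1)) (Pl (V 1) (V 0))))"]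
      by (simp add: abelian_grp_def) blast
    interpret saturated_comm_ord_group ?G ls
      by unfold_locales (use comm in simp)
    have pow_eq: "evalt pl (tpow n t) e = evalt pl t e [^]\<^bsub>?G\<^esub> Suc n" for n t e
      using evalt_tpow[of n t e] by simp
    show ?thesis
    proof (cases "divisible_grp TYPE('g)")
      case False
      then obtain a :: 'g and n where n: "n \<ge> 1" and a: "\<And>g. nmul n g \<noteq> a"
        unfolding divisible_grp_def by blast
      then obtain m where m: "n = Suc m" by (cases n) auto
      \<comment> \<open>For fixed \<open>n\<close>, the lack of an \<open>n\<close>-th root of some
        element is a single sentence.\<close>
      have "\<exists>x. \<forall>y. y [^]\<^bsub>?G\<^esub> Suc m \<noteq> x"
        using tr[of "Ex 0 (All 1 (Neg (Eq (tpow m (V 1)) (V 0))))"] a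
        unfolding m by (auto simp: evalt_plus_tpow pow_eq simp del: nat_pow_Suc)
      then show ?thesis using not_dp_small_if_not_divisible[of n] False n m by auto
    next
      case div: True
      have "\<exists>y. y [^]\<^bsub>?G\<^esub> n = x" if pos: "n > 0" for n :: nat and x
      proof -
        obtain m where m: "n = Suc m" using pos by (cases n) auto
        show ?thesis
          using tr[of "All 0 (Ex 1 (Eq (tpow m (V 1)) (V 0)))"] div
          unfolding m divisible_grp_def by (simp add: evalt_plus_tpow pow_eq del: nat_pow_Suc) blast
      qed
      moreover have "\<exists>x. x \<noteq> z"
      proof -
        obtain x y :: 'g where "x \<noteq> y"
          using assms(2) by (metis finite.emptyI finite.insertI finite_subset insertI1 subsetI)
        then have "\<exists>x y :: 'm. x \<noteq> y"
          using tr[of "Ex 0 (Ex 1 (Neg (Eq (V 0) (V 1))))"] by simp blast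
        then show ?thesis by metis
      qed
      ultimately interpret div_ord_group ?G ls
        by unfold_locales simp_all
      have "dp_small pl ls"
      proof (rule ccontr)
        assume "\<not> dp_small pl ls"
        then obtain \<phi> c \<psi> b x where "\<forall>i j :: nat.
            (\<forall>i' :: nat. sat pl ls (\<phi> i') ((c i')(0 := x i j)) \<longleftrightarrow> i' = i) \<and>
            (\<forall>j' :: nat. sat pl ls \<psi> ((b j')(0 := x i j)) \<longleftrightarrow> j' = j)"
          unfolding monster_dp_small_iff[OF sat] not_not by (elim exE) (rule that)
        then show False using no_array[of \<phi> c x \<psi> b] by simp
      qed
      then show ?thesis using True div by simp
    qed
  qed
qed

end
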